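(* Let $m,n\ge 1$ be integers and let $r$ be an integer such that $\gcd(m,n)=\gcd(m,r-1)=1$ and $r^n\equiv 1\pmod m$. Let $\mathrm{ZM}(m,n,r)=\langle a,b\mid a^m=b^n=1,\ b^{-1}ab=a^r\rangle$. Then the number of normal subgroups of $\mathrm{ZM}(m,n,r)$ is $$|N(\mathrm{ZM}(m,n,r))|=\sum_{n_1\mid n}\tau\big(\gcd(m,r^{n_1}-1)\big),$$ where the sum is over all positive divisors $n_1$ of $n$.
   Context: For a group $G$, $N(G)$ denotes the lattice (set) of all normal subgroups of $G$. For a positive integer $k$, $\tau(k)$ denotes the number of distinct positive divisors of $k$. The group $\mathrm{ZM}(m,n,r)$ (a ZM-group, i.e. a finite group all of whose Sylow subgroups are cyclic) has order $mn$. *)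

theory Defs
  imports "HOL-Algebra.Coset" "HOL-Number_Theory.Cong"
begin

text \<open>
  Words in the generators and their formal inverses: the letter \<open>(x, True)\<close> stands for \<open>x\<close>,
  the letter \<open>(x, False)\<close> for its inverse. All elements of the type \<open>'g\<close> are generators.
\<close>

type_synonym 'g word = "('g \<times> bool) list"

definition gen_pow :: "'g \<Rightarrow> int \<Rightarrow> 'g word" where
  "gen_pow x k = replicate (nat \<bar>k\<bar>) (x, 0 \<le> k)"

text \<open>
  The least congruence on words that identifies the two sides of every defining relation
  in \<open>R\<close> and makes each letter inverse to its formal inverse.
\<close>

inductive pres_eq :: "('g word \<times> 'g word) set \<Rightarrow> 'g word \<Rightarrow> 'g word \<Rightarrow> bool"
  for R where
  relation: "(u, v) \<in> R \<Longrightarrow> pres_eq R u v"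
| cancel: "pres_eq R [(x, s), (x, \<not> s)] []"
| refl: "pres_eq R u u"
| sym: "pres_eq R u v \<Longrightarrow> pres_eq R v u"
| trans: "pres_eq R u v \<Longrightarrow> pres_eq R v w \<Longrightarrow> pres_eq R u w"
| append: "pres_eq R u u' \<Longrightarrow> pres_eq R v v' \<Longrightarrow> pres_eq R (u @ v) (u' @ v')"

definition pres_class :: "('g word \<times> 'g word) set \<Rightarrow> 'g word \<Rightarrow> 'g word set" where
  "pres_class R u = {v. pres_eq R u v}"

definition presented_group :: "('g word \<times> 'g word) set \<Rightarrow> 'g word set monoid" where
  "presented_group R =
     \<lparr>carrier = range (pres_class R),
      monoid.mult = (\<lambda>X Y. \<Union>u\<in>X. \<Union>v\<in>Y. pres_class R (u @ v)),
      monoid.one = pres_class R []\<rparr>"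

lemma pres_class_eq_iff: "pres_class R u = pres_class R v \<longleftrightarrow> pres_eq R u v"
  unfolding pres_class_def set_eq_iff mem_Collect_eq
  by (meson pres_eq.refl pres_eq.sym pres_eq.trans)

lemma presented_group_mult:
  "pres_class R u \<otimes>\<^bsub>presented_group R\<^esub> pres_class R v = pres_class R (u @ v)"
proof -
  have "pres_class R (u' @ v') = pres_class R (u @ v)"
    if "u' \<in> pres_class R u" "v' \<in> pres_class R v" for u' v'
  proof -
    from that have "pres_eq R (u @ v) (u' @ v')"
      by (simp add: pres_class_def pres_eq.append)
    then show ?thesis
      unfolding pres_class_eq_iff by (rule pres_eq.sym)
  qed
  moreover have "u \<in> pres_class R u" "v \<in> pres_class R v"
    by (simp_all add: pres_class_def pres_eq.refl)
  ultimately have "(\<Union>u'\<in>pres_class R u. \<Union>v'\<in>pres_class R v. pres_class R (u' @ v')) =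
      pres_class R (u @ v)"
    by blast
  then show ?thesis
    by (simp add: presented_group_def)
qed

lemma pres_eq_left_inverse:
  "pres_eq R (rev (map (\<lambda>(x, s). (x, \<not> s)) u) @ u) []"
proof (induction u)
  case Nil
  then show ?case by (simp add: pres_eq.refl)
next
  case (Cons l u)
  obtain x s where l: "l = (x, s)" by fastforce
  let ?w = "rev (map (\<lambda>(x, s). (x, \<not> s)) u)"
  have "pres_eq R [(x, \<not> s), (x, s)] []"
    using pres_eq.cancel[of R x "\<not> s"] by simp
  then have "pres_eq R (?w @ ([(x, \<not> s), (x, s)] @ u)) (?w @ ([] @ u))"
    by (intro pres_eq.append pres_eq.refl)
  then have "pres_eq R (?w @ ([(x, \<not> s), (x, s)] @ u)) []"
    using Cons.IH by (auto intro: pres_eq.trans)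
  then show ?case
    by (simp add: l)
qed

lemma group_presented_group: "group (presented_group R)"
proof (rule groupI)
  let ?G = "presented_group R"
  have carrier: "carrier ?G = range (pres_class R)" and one: "\<one>\<^bsub>?G\<^esub> = pres_class R []"
    by (simp_all add: presented_group_def)
  show "x \<otimes>\<^bsub>?G\<^esub> y \<in> carrier ?G" if "x \<in> carrier ?G" "y \<in> carrier ?G" for x y
    using that by (auto simp: carrier presented_group_mult)
  show "\<one>\<^bsub>?G\<^esub> \<in> carrier ?G"
    by (simp add: carrier one)
  show "x \<otimes>\<^bsub>?G\<^esub> y \<otimes>\<^bsub>?G\<^esub> z = x \<otimes>\<^bsub>?G\<^esub> (y \<otimes>\<^bsub>?G\<^esub> z)"
    if "x \<in> carrier ?G" "y \<in> carrier ?G" "z \<in> carrier ?G" for x y z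
    using that by (auto simp: carrier presented_group_mult)
  show "\<one>\<^bsub>?G\<^esub> \<otimes>\<^bsub>?G\<^esub> x = x" if "x \<in> carrier ?G" for x
    using that by (auto simp: carrier one presented_group_mult)
  show "\<exists>y\<in>carrier ?G. y \<otimes>\<^bsub>?G\<^esub> x = \<one>\<^bsub>?G\<^esub>" if "x \<in> carrier ?G" for x
  proof -
    from that obtain u where "x = pres_class R u"
      by (auto simp: carrier)
    then have "pres_class R (rev (map (\<lambda>(x, s). (x, \<not> s)) u)) \<otimes>\<^bsub>?G\<^esub> x = \<one>\<^bsub>?G\<^esub>"
      by (simp add: one presented_group_mult pres_class_eq_iff pres_eq_left_inverse)
    then show ?thesis
      by (auto simp: carrier)
  qed
qed

datatype zm_gen = gen_a | gen_b

definition ZM :: "nat \<Rightarrow> nat \<Rightarrow> int \<Rightarrow> zm_gen word set monoid" where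
  "ZM m n r = presented_group
     {(gen_pow gen_a (int m), []),
      (gen_pow gen_b (int n), []),
      (gen_pow gen_b (- 1) @ gen_pow gen_a 1 @ gen_pow gen_b 1, gen_pow gen_a r)}"

definition normal_subgroups :: "('a, 'b) monoid_scheme \<Rightarrow> 'a set set" where
  "normal_subgroups G = {H. H \<lhd> G}"

text \<open>Only meaningful for \<open>k > 0\<close>; for \<open>k = 0\<close> the set of divisors is infinite and the value is 0.\<close>

definition divisor_count :: "nat \<Rightarrow> nat" where
  "divisor_count k = card {d. d dvd k}"

end

theory Submission
  imports Defs "HOL-Algebra.Generated_Groups"
begin

text \<open>
  Every element of \<open>ZM(m,n,r)\<close> is \<open>b\<^sup>j a\<^sup>i\<close> with \<open>j\<close> unique modulo \<open>n\<close> and \<open>i\<close> unique modulo \<open>m\<close>.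
  If \<open>H\<close> is normal and contains \<open>h = b\<^sup>j a\<^sup>i\<close>, it contains
  \<open>h\<inverse> (b\<inverse> h b)\<close>, the power of \<open>a\<close> with exponent \<open>i (r - 1)\<close>. Since \<open>r - 1\<close> is prime to \<open>m\<close>,
  it follows that \<open>a\<^sup>i\<close> and \<open>b\<^sup>j\<close> lie in \<open>H\<close> separately. So \<open>H\<close> is determined by the divisors
  \<open>d\<close> of \<open>n\<close> and \<open>e\<close> of \<open>m\<close> generating the exponents of the powers of \<open>b\<close> and of \<open>a\<close> in \<open>H\<close>.
  A pair \<open>(d, e)\<close> occurs if and only if \<open>e\<close> divides \<open>r ^ d - 1\<close>: the commutator of \<open>b ^ d\<close> and \<open>a\<close> is
  a power of \<open>a\<close> with that exponent up to sign.
\<close>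

section \<open>Powers of one element that lie in a subgroup\<close>

text \<open>The exponents \<open>k\<close> with \<open>x [^] k\<close> in \<open>H\<close> form a
  subgroup of the integers containing \<open>n\<close>. Division with remainder shows that they are
  the multiples of the least positive one.\<close>

lemma (in group) int_pow_mem_subgroup_iff:
  assumes H: "subgroup H G" and x: "x \<in> carrier G" and n: "n > 0" "x [^] (n::nat) = \<one>"
  obtains d :: nat where "d dvd n" "\<And>k::int. x [^] k \<in> H \<longleftrightarrow> int d dvd k"
proof -
  define d where "d = (LEAST d::nat. d > 0 \<and> x [^] d \<in> H)"
  have "n > 0 \<and> x [^] n \<in> H"
    using n subgroup.one_closed[OF H] by simp
  then have d: "d > 0" "x [^] d \<in> H"
    unfolding d_def by (metis (mono_tags, lifting) LeastI)+
  have least: "\<not> (e > 0 \<and> x [^] e \<in> H)" if "e < d" for e :: nat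
    using that unfolding d_def by (rule not_less_Least)
  have mult: "x [^] (int d * q) \<in> H" for q
    using d(2) subgroup_int_pow_closed[OF H, of "x [^] d" q] x
    by (simp add: int_pow_int int_pow_pow flip: int_pow_int)
  have iff: "x [^] k \<in> H \<longleftrightarrow> int d dvd k" for k :: int
  proof
    assume k: "x [^] k \<in> H"
    have "x [^] (k mod int d) = x [^] k \<otimes> inv (x [^] (int d * (k div int d)))"
      using x by (simp add: minus_mult_div_eq_mod int_pow_diff flip: int_pow_diff)
    then have "x [^] (k mod int d) \<in> H"
      using k mult H by (simp add: subgroup.m_closed subgroup.m_inv_closed)
    then have "x [^] nat (k mod int d) \<in> H"
      using d(1) by (simp flip: int_pow_int)
    moreover have "nat (k mod int d) < d"
      using d(1) by (simp add: nat_less_iff)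
    ultimately have "nat (k mod int d) = 0"
      using least \<open>x [^] nat (k mod int d) \<in> H\<close> neq0_conv by blast
    then have "k mod int d = 0"
      using d(1) pos_mod_sign[of "int d" k] by linarith
    then show "int d dvd k"
      by (rule mod_0_imp_dvd)
  next
    assume "int d dvd k"
    then show "x [^] k \<in> H"
      using mult by (auto simp: dvd_def)
  qed
  have "d dvd n"
    using iff[of "int n"] n subgroup.one_closed[OF H] by (simp add: int_pow_int)
  then show thesis
    using iff by (rule that)
qed

section \<open>Arithmetic of the normal form\<close>

text \<open>Kept apart from \<open>split_metacyclic\<close> because the existence of normal forms in
  the presented group is itself proved with \<open>normal_form_mult\<close>.\<close>

locale conjugation_by_power = group G for G (structure) +
  fixes a b :: 'a and r :: int
  assumes a_closed [simp]: "a \<in> carrier G"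
    and b_closed [simp]: "b \<in> carrier G"
    and conj_a: "inv b \<otimes> a \<otimes> b = a [^] r"
begin

text \<open>Conjugation by \<open>b\<close> is an endomorphism, so its value on \<open>a\<close>
  determines its values on all powers of \<open>a\<close>.\<close>

lemma int_pow_a_b: "a [^] (i::int) \<otimes> b = b \<otimes> a [^] (i * r)"
proof -
  have "b \<otimes> (inv b \<otimes> x) = x" if "x \<in> carrier G" for x
    using that by (simp flip: m_assoc)
  then have hom: "(\<lambda>x. inv b \<otimes> x \<otimes> b) \<in> hom G G"
    by (intro homI) (simp_all add: m_assoc)
  have "inv b \<otimes> a [^] i \<otimes> b = (a [^] r) [^] i"
    using hom_int_pow[OF hom a_closed is_group is_group, of i] by (simp add: conj_a)
  then show ?thesis
    by (simp add: int_pow_pow m_assoc inv_solve_left' mult.commute)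
qed

lemma int_pow_a_pow_b:
  "a [^] (i::int) \<otimes> b [^] (l::nat) = b [^] l \<otimes> a [^] (i * r ^ l)"
proof (induction l)
  case (Suc l)
  have "a [^] i \<otimes> b [^] Suc l = b [^] l \<otimes> (a [^] (i * r ^ l) \<otimes> b)"
    using Suc by (simp flip: m_assoc)
  then show ?case
    by (simp add: int_pow_a_b m_assoc mult_ac)
qed simp

text \<open>This is the multiplication of a semidirect product. The exponents of \<open>b\<close>
  are natural numbers so that \<open>r ^ l\<close> is an integer.\<close>

lemma normal_form_mult:
  "b [^] (j::nat) \<otimes> a [^] (i::int) \<otimes> (b [^] (l::nat) \<otimes> a [^] (k::int)) =
    b [^] (j + l) \<otimes> a [^] (i * r ^ l + k)"
proof -
  have "b [^] j \<otimes> a [^] i \<otimes> (b [^] l \<otimes> a [^] k) = b [^] j \<otimes> (a [^] i \<otimes> b [^] l) \<otimes> a [^] k"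
    by (simp add: m_assoc)
  also have "\<dots> = b [^] (j + l) \<otimes> a [^] (i * r ^ l + k)"
    unfolding int_pow_a_pow_b by (simp add: m_assoc int_pow_mult flip: nat_pow_mult)
  finally show ?thesis .
qed

end

section \<open>Classification and count of the normal subgroups\<close>

text \<open>Uniqueness of the exponents is assumed at the identity only;
  \<open>normal_form_eq_imp\<close> derives the general case.\<close>

locale split_metacyclic = conjugation_by_power +
  fixes m n :: nat
  assumes m_pos: "m > 0" and n_pos: "n > 0"
    and normal_form: "x \<in> carrier G \<Longrightarrow> \<exists>(j::nat) (i::int). x = b [^] j \<otimes> a [^] i"
    and normal_form_eq_one_iff:
      "b [^] (j::nat) \<otimes> a [^] (i::int) = \<one> \<longleftrightarrow> n dvd j \<and> int m dvd i"
begin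

lemma pow_a: "a [^] m = \<one>" and pow_b: "b [^] n = \<one>"
  using normal_form_eq_one_iff[of 0 "int m"] normal_form_eq_one_iff[of n 0]
  by (simp_all add: int_pow_int)

lemma pow_b_mult: "b [^] (n * j) = \<one>"
  by (simp add: pow_b flip: nat_pow_pow)

text \<open>Since \<open>b [^] n = \<one>\<close>, the natural number \<open>j * (n - 1)\<close>
  serves as the exponent \<open>- j\<close>.\<close>

lemma normal_form_inv:
  "inv (b [^] (j::nat) \<otimes> a [^] (i::int)) =
    b [^] (j * (n - 1)) \<otimes> a [^] (- i * r ^ (j * (n - 1)))"
proof -
  have "j + j * (n - 1) = n * j"
    using n_pos by (cases n) auto
  then have "b [^] j \<otimes> a [^] i \<otimes> (b [^] (j * (n - 1)) \<otimes> a [^] (- i * r ^ (j * (n - 1)))) = \<one>"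
    unfolding normal_form_mult by (simp add: pow_b_mult)
  then have "inv (b [^] (j * (n - 1)) \<otimes> a [^] (- i * r ^ (j * (n - 1)))) = b [^] j \<otimes> a [^] i"
    by (intro inv_equality) simp_all
  then show ?thesis
    by (metis inv_inv m_closed nat_pow_closed int_pow_closed a_closed b_closed)
qed

text \<open>Cancelling \<open>b [^] l\<close> on the left and \<open>a [^] k\<close> on the right
  reduces to the identity. The first conclusion is congruence of \<open>j\<close> and
  \<open>l\<close> modulo \<open>n\<close>, with \<open>l * (n - 1)\<close> in place of
  \<open>- l\<close>.\<close>

lemma normal_form_eq_imp:
  assumes "b [^] (j::nat) \<otimes> a [^] (i::int) = b [^] (l::nat) \<otimes> a [^] (k::int)"
  shows "n dvd j + l * (n - 1)" "int m dvd i - k"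
proof -
  have l: "l * (n - 1) + l = n * l"
    using n_pos by (cases n) auto
  have "b [^] (l * (n - 1)) \<otimes> (b [^] j \<otimes> a [^] i) \<otimes> a [^] (- k) =
      b [^] (l * (n - 1)) \<otimes> (b [^] l \<otimes> a [^] k) \<otimes> a [^] (- k)"
    using assms by simp
  also have "\<dots> = b [^] (l * (n - 1) + l) \<otimes> a [^] (k - k)"
    by (simp add: m_assoc int_pow_neg flip: nat_pow_mult)
  also have "\<dots> = \<one>"
    unfolding l pow_b_mult by simp
  also have "b [^] (l * (n - 1)) \<otimes> (b [^] j \<otimes> a [^] i) \<otimes> a [^] (- k) =
      b [^] (l * (n - 1) + j) \<otimes> a [^] (i - k)"
    unfolding diff_conv_add_uminus int_pow_mult[OF a_closed]
    by (simp add: m_assoc flip: nat_pow_mult)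
  finally show "n dvd j + l * (n - 1)" "int m dvd i - k"
    by (simp_all add: normal_form_eq_one_iff add.commute)
qed

definition standard_subgroup :: "nat \<Rightarrow> nat \<Rightarrow> 'a set" where
  "standard_subgroup d e = {b [^] j \<otimes> a [^] i | (j::nat) (i::int). d dvd j \<and> int e dvd i}"

text \<open>The exponents are unique modulo \<open>n\<close> and \<open>m\<close>, so divisibility
  by divisors of \<open>n\<close> and \<open>m\<close> does not depend on their choice.\<close>

lemma normal_form_mem_standard_subgroup_iff:
  assumes "d dvd n" "e dvd m"
  shows "b [^] (j::nat) \<otimes> a [^] (i::int) \<in> standard_subgroup d e \<longleftrightarrow> d dvd j \<and> int e dvd i"
proof
  assume "b [^] j \<otimes> a [^] i \<in> standard_subgroup d e"
  then obtain l :: nat and k :: int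
    where eq: "b [^] j \<otimes> a [^] i = b [^] l \<otimes> a [^] k" and "d dvd l" "int e dvd k"
    unfolding standard_subgroup_def by blast
  note normal_form_eq_imp[OF eq]
  with assms have "d dvd j + l * (n - 1)" "int e dvd i - k"
    by (auto intro: dvd_trans[of "int e" "int m"] dvd_trans[of d n])
  with \<open>d dvd l\<close> \<open>int e dvd k\<close> show "d dvd j \<and> int e dvd i"
    by (metis dvd_add_left_iff dvd_diff_left_iff dvd_mult2)
qed (auto simp: standard_subgroup_def)

text \<open>Conjugating \<open>b [^] j \<otimes> a [^] i\<close> by
  \<open>b [^] l \<otimes> a [^] k\<close> keeps \<open>j\<close> modulo \<open>n\<close> and turns
  \<open>i\<close> into \<open>k * (r ^ j - 1) + i\<close> times a power of \<open>r\<close>. For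
  \<open>d dvd j\<close>, \<open>e\<close> divides \<open>r ^ j - 1\<close>, because
  \<open>r ^ d - 1\<close> does.\<close>

lemma normal_standard_subgroup:
  assumes d: "d dvd n" and e: "e dvd m" "int e dvd r ^ d - 1"
  shows "standard_subgroup d e \<lhd> G"
proof -
  note mem_iff = normal_form_mem_standard_subgroup_iff[OF d e(1)]
  have pow: "int e dvd r ^ l - 1" if "d dvd l" for l
  proof -
    from that obtain q where "l = d * q" ..
    then have "r ^ d - 1 dvd r ^ l - 1"
      by (simp add: power_mult) (metis dvd_triv_left power_diff_1_eq)
    with e(2) show ?thesis by (rule dvd_trans)
  qed
  have elem: "\<exists>(j::nat) (i::int). x = b [^] j \<otimes> a [^] i \<and> d dvd j \<and> int e dvd i"
    if "x \<in> standard_subgroup d e" for x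
    using that unfolding standard_subgroup_def by blast
  have "subgroup (standard_subgroup d e) G"
  proof (rule subgroupI)
    show "standard_subgroup d e \<subseteq> carrier G"
      by (auto simp: standard_subgroup_def)
    show "standard_subgroup d e \<noteq> {}"
      using mem_iff[of 0 0] by auto
    show "inv x \<in> standard_subgroup d e" if "x \<in> standard_subgroup d e" for x
      using elem[OF that] by (auto simp: mem_iff normal_form_inv)
    show "x \<otimes> y \<in> standard_subgroup d e"
      if "x \<in> standard_subgroup d e" "y \<in> standard_subgroup d e" for x y
      using elem[OF that(1)] elem[OF that(2)] by (auto simp: mem_iff normal_form_mult)
  qed
  moreover have "x \<otimes> h \<otimes> inv x \<in> standard_subgroup d e"
    if x: "x \<in> carrier G" and h: "h \<in> standard_subgroup d e" for x h
  proof -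
    obtain l :: nat and k :: int where x: "x = b [^] l \<otimes> a [^] k"
      using normal_form[OF x] by blast
    obtain j :: nat and i :: int where h: "h = b [^] j \<otimes> a [^] i" "d dvd j" "int e dvd i"
      using elem[OF h] by blast
    have "l + j + l * (n - 1) = n * l + j"
      using n_pos by (cases n) auto
    then have "d dvd l + j + l * (n - 1)"
      unfolding \<open>_ = n * l + j\<close> using d h(2) by simp
    moreover have "(k * r ^ j + i) * r ^ (l * (n - 1)) + - k * r ^ (l * (n - 1)) =
        (k * (r ^ j - 1) + i) * r ^ (l * (n - 1))"
      by (simp add: algebra_simps)
    ultimately show ?thesis
      unfolding x h(1) normal_form_inv normal_form_mult mem_iff
      using h(3) pow[OF h(2)] by simp
  qed
  ultimately show ?thesis
    by (simp add: normal_inv_iff)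
qed

lemma normal_subgroup_is_standard:
  assumes H: "H \<lhd> G" and coprime: "coprime (int m) (r - 1)"
  obtains d e where "d dvd n" "e dvd m" "int e dvd r ^ d - 1" "H = standard_subgroup d e"
proof -
  have sub: "subgroup H G"
    using H by (rule normal_imp_subgroup)
  obtain e where e: "e dvd m" "\<And>k::int. a [^] k \<in> H \<longleftrightarrow> int e dvd k"
    using int_pow_mem_subgroup_iff[OF sub a_closed m_pos pow_a] by blast
  obtain d where d: "d dvd n" "\<And>k::int. b [^] k \<in> H \<longleftrightarrow> int d dvd k"
    using int_pow_mem_subgroup_iff[OF sub b_closed n_pos pow_b] by blast
  have d_nat: "b [^] k \<in> H \<longleftrightarrow> d dvd k" for k :: nat
    using d(2)[of "int k"] by (simp add: int_pow_int)
  have "b [^] d \<in> H"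
    by (simp add: d_nat)
  \<comment> \<open>The second factor is the conjugate of \<open>b [^] d\<close> by
    \<open>inv a\<close>, so normality puts this commutator in \<open>H\<close>; moving
    \<open>a\<close> past \<open>b [^] d\<close> makes it a power of \<open>a\<close>.\<close>
  then have "inv (b [^] d) \<otimes> (inv (inv a) \<otimes> b [^] d \<otimes> inv a) \<in> H"
    by (intro subgroup.m_closed[OF sub] subgroup.m_inv_closed[OF sub] normal.inv_op_closed1[OF H])
      simp_all
  also have "inv (b [^] d) \<otimes> (inv (inv a) \<otimes> b [^] d \<otimes> inv a) = a [^] (r ^ d - 1)"
    using int_pow_a_pow_b[of 1 d]
    by (simp add: int_pow_diff m_assoc inv_solve_left')
  finally have e_dvd: "int e dvd r ^ d - 1"
    by (simp add: e(2))
  have mem: "b [^] j \<otimes> a [^] i \<in> H \<longleftrightarrow> d dvd j \<and> int e dvd i" for j :: nat and i :: int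
  proof
    assume h: "b [^] j \<otimes> a [^] i \<in> H"
    have "inv (b [^] j \<otimes> a [^] i) \<otimes> (inv b \<otimes> (b [^] j \<otimes> a [^] i) \<otimes> b) \<in> H"
      by (intro subgroup.m_closed[OF sub] subgroup.m_inv_closed[OF sub]
          normal.inv_op_closed1[OF H] h) simp_all
    also have "inv b \<otimes> (b [^] j \<otimes> a [^] i) \<otimes> b = b [^] j \<otimes> a [^] (i * r)"
    proof -
      have "(b [^] j \<otimes> a [^] i) \<otimes> b = b \<otimes> (b [^] j \<otimes> a [^] (i * r))"
        using normal_form_mult[of j i 1 0] normal_form_mult[of 1 0 j "i * r"] by simp
      then show ?thesis
        by (simp add: m_assoc inv_solve_left')
    qed
    also have "inv (b [^] j \<otimes> a [^] i) \<otimes> (b [^] j \<otimes> a [^] (i * r)) = a [^] (i * (r - 1))"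
      by (simp add: inv_solve_left' m_assoc right_diff_distrib flip: int_pow_mult)
    finally have "int e dvd i * (r - 1)"
      by (simp add: e(2))
    \<comment> \<open>Coprimality with \<open>r - 1\<close> passes from \<open>m\<close> to its
      divisor \<open>e\<close> and allows the factor \<open>r - 1\<close> to be cancelled.\<close>
    moreover have "coprime (int e) (r - 1)"
      using coprime e(1) by (meson coprime_divisors dvd_refl of_nat_dvd_iff)
    ultimately have "int e dvd i"
      by (simp add: coprime_dvd_mult_left_iff)
    moreover from this have "b [^] j \<otimes> a [^] i \<otimes> inv (a [^] i) \<in> H"
      using sub h by (simp add: e(2) subgroup.m_closed subgroup.m_inv_closed)
    then have "b [^] j \<in> H"
      by (simp add: m_assoc)
    ultimately show "d dvd j \<and> int e dvd i"
      by (simp add: d_nat)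
  next
    assume "d dvd j \<and> int e dvd i"
    then show "b [^] j \<otimes> a [^] i \<in> H"
      using sub by (simp add: e(2) d_nat subgroup.m_closed)
  qed
  have "H = standard_subgroup d e"
  proof (rule Set.set_eqI)
    fix x
    \<comment> \<open>Both sets lie in the carrier, so it suffices to compare them on normal
      forms.\<close>
    have "x \<in> carrier G" if "x \<in> H \<or> x \<in> standard_subgroup d e"
      using that sub subgroup.mem_carrier[OF sub] by (auto simp: standard_subgroup_def)
    then show "x \<in> H \<longleftrightarrow> x \<in> standard_subgroup d e"
      using normal_form[of x] mem normal_form_mem_standard_subgroup_iff[OF d(1) e(1)] by metis
  qed
  with d(1) e(1) e_dvd show thesis
    by (rule that)
qed

lemma inj_on_standard_subgroup:
  "inj_on (\<lambda>(d, e). standard_subgroup d e) ({d. d dvd n} \<times> {e. e dvd m})"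
proof (rule inj_onI, clarify)
  fix d e d' e'
  assume dvd: "d dvd n" "d' dvd n" "e dvd m" "e' dvd m"
    and eq: "standard_subgroup d e = standard_subgroup d' e'"
  have "d dvd j \<and> int e dvd i \<longleftrightarrow> d' dvd j \<and> int e' dvd i" for j :: nat and i :: int
    using normal_form_mem_standard_subgroup_iff dvd eq by metis
  \<comment> \<open>Testing membership of \<open>b [^] d\<close>, \<open>b [^] d'\<close>,
    \<open>a [^] e\<close> and \<open>a [^] e'\<close> gives mutual divisibility.\<close>
  from this[of d 0] this[of d' 0] this[of 0 "int e"] this[of 0 "int e'"]
  show "d = d' \<and> e = e'"
    by (auto intro: dvd_antisym)
qed

lemma card_normal_subgroups:
  assumes "coprime (int m) (r - 1)"
  shows "card (normal_subgroups G) =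
    (\<Sum>d | d dvd n. divisor_count (nat (gcd (int m) (r ^ d - 1))))"
proof -
  let ?E = "\<lambda>d. {e. e dvd nat (gcd (int m) (r ^ d - 1))}"
  \<comment> \<open>For fixed \<open>d\<close>, the admissible \<open>e\<close> are exactly the
    divisors of the gcd in the formula, so each summand counts the second components over
    \<open>d\<close>.\<close>
  have E: "e \<in> ?E d \<longleftrightarrow> e dvd m \<and> int e dvd r ^ d - 1" for d e
    by (simp flip: int_dvd_int_iff)
  have "normal_subgroups G = (\<lambda>(d, e). standard_subgroup d e) ` Sigma {d. d dvd n} ?E"
  proof (intro equalityI subsetI)
    fix H assume "H \<in> normal_subgroups G"
    then obtain d e where "d dvd n" "e dvd m" "int e dvd r ^ d - 1" "H = standard_subgroup d e"
      using normal_subgroup_is_standard[OF _ assms] by (auto simp: normal_subgroups_def)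
    then show "H \<in> (\<lambda>(d, e). standard_subgroup d e) ` Sigma {d. d dvd n} ?E"
      using E by (intro image_eqI[of _ _ "(d, e)"] SigmaI) auto
  next
    fix H assume "H \<in> (\<lambda>(d, e). standard_subgroup d e) ` Sigma {d. d dvd n} ?E"
    then show "H \<in> normal_subgroups G"
      using E normal_standard_subgroup by (auto simp: normal_subgroups_def)
  qed
  moreover have "inj_on (\<lambda>(d, e). standard_subgroup d e) (Sigma {d. d dvd n} ?E)"
    by (rule inj_on_subset[OF inj_on_standard_subgroup]) (use E in auto)
  ultimately have "card (normal_subgroups G) = card (Sigma {d. d dvd n} ?E)"
    by (simp add: card_image)
  also have "\<dots> = (\<Sum>d | d dvd n. card (?E d))"
    using n_pos m_pos by (intro card_SigmaI) (auto intro!: finite_divisors_nat)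
  finally show ?thesis
    by (simp add: divisor_count_def)
qed

end

section \<open>Exponents of words modulo the defining relations\<close>

text \<open>
  Uniqueness of the normal form: the exponents \<open>(j, i)\<close> of a word in the normal form \<open>b\<^sup>j a\<^sup>i\<close> are
  computed in the semidirect product monoid \<open>(j, i) (l, k) = (j + l, i r\<^sup>l + k)\<close> on
  \<open>\<nat> \<times> \<int>\<close>. The inverse of \<open>b\<close> counts as \<open>b ^ (n - 1)\<close>, so that only natural powers of \<open>r\<close> occur;
  the defining relations then hold modulo \<open>n\<close> and \<open>m\<close> only.
\<close>

fun exponent_b :: "nat \<Rightarrow> zm_gen word \<Rightarrow> nat" where
  "exponent_b n [] = 0"
| "exponent_b n ((gen_a, s) # w) = exponent_b n w"
| "exponent_b n ((gen_b, s) # w) = (if s then 1 else n - 1) + exponent_b n w"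

fun exponent_a :: "nat \<Rightarrow> int \<Rightarrow> zm_gen word \<Rightarrow> int" where
  "exponent_a n r [] = 0"
| "exponent_a n r ((gen_a, s) # w) = (if s then 1 else - 1) * r ^ exponent_b n w + exponent_a n r w"
| "exponent_a n r ((gen_b, s) # w) = exponent_a n r w"

lemma exponent_b_append: "exponent_b n (u @ v) = exponent_b n u + exponent_b n v"
  by (induction n u rule: exponent_b.induct) auto

lemma exponent_a_append:
  "exponent_a n r (u @ v) = exponent_a n r u * r ^ exponent_b n v + exponent_a n r v"
  by (induction n r u rule: exponent_a.induct)
    (auto simp: exponent_b_append algebra_simps power_add)

lemma exponents_gen_pow_a: "exponent_b n (gen_pow gen_a k) = 0" "exponent_a n r (gen_pow gen_a k) = k"
proof -
  have "exponent_b n (replicate l (gen_a, s)) = 0" for l s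
    by (induction l) auto
  moreover from this have
    "exponent_a n r (replicate l (gen_a, s)) = (if s then int l else - int l)" for l s
    by (induction l) auto
  ultimately show "exponent_b n (gen_pow gen_a k) = 0" "exponent_a n r (gen_pow gen_a k) = k"
    by (auto simp: gen_pow_def)
qed

text \<open>The first equation is restricted to nonnegative powers because each inverse letter
  contributes \<open>n - 1\<close> and not \<open>- 1\<close>.\<close>

lemma exponents_gen_pow_b:
  "exponent_b n (gen_pow gen_b (int k)) = k" "exponent_a n r (gen_pow gen_b k') = 0"
proof -
  have "exponent_b n (replicate l (gen_b, True)) = l" for l
    by (induction l) auto
  moreover have "exponent_a n r (replicate l (gen_b, s)) = 0" for l s
    by (induction l) auto
  ultimately show
    "exponent_b n (gen_pow gen_b (int k)) = k" "exponent_a n r (gen_pow gen_b k') = 0"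
    by (simp_all add: gen_pow_def)
qed

definition ZM_relations :: "nat \<Rightarrow> nat \<Rightarrow> int \<Rightarrow> (zm_gen word \<times> zm_gen word) set" where
  "ZM_relations m n r =
     {(gen_pow gen_a (int m), []),
      (gen_pow gen_b (int n), []),
      (gen_pow gen_b (- 1) @ gen_pow gen_a 1 @ gen_pow gen_b 1, gen_pow gen_a r)}"

lemma ZM_eq: "ZM m n r = presented_group (ZM_relations m n r)"
  by (simp add: ZM_def ZM_relations_def)

lemma pres_eq_ZM_imp_exponents_cong:
  assumes "pres_eq (ZM_relations m n r) u v" and n: "n \<ge> 1" and r: "[r ^ n = 1] (mod int m)"
  shows "[exponent_b n u = exponent_b n v] (mod n) \<and>
    [exponent_a n r u = exponent_a n r v] (mod int m)"
  using assms(1)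
proof induction
  case (relation u v)
  \<comment> \<open>In the conjugation relation the two letters of \<open>b\<close> contribute
    \<open>n - 1 + 1 = n\<close>, which vanishes modulo \<open>n\<close>, and the \<open>b\<close>
    to the right of \<open>a\<close> turns its exponent into \<open>r\<close>.\<close>
  have "exponent_b n (gen_pow gen_b (- 1)) = n - 1" "gen_pow gen_b 1 = [(gen_b, True)]"
    by (simp_all add: gen_pow_def)
  with relation n show ?case
    by (auto simp: ZM_relations_def exponent_b_append exponent_a_append exponents_gen_pow_a
        exponents_gen_pow_b cong_def)
next
  case (cancel x s)
  show ?case
    using n by (cases x; cases s) (simp_all add: cong_def)
next
  case (append u u' v v')
  \<comment> \<open>Concatenation twists by \<open>r ^ exponent_b n v\<close>, while
    \<open>exponent_b\<close> is known modulo \<open>n\<close> only; \<open>r ^ n\<close> being 1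
    modulo \<open>m\<close> makes the twist well defined.\<close>
  have pow: "[r ^ j = r ^ (j mod n)] (mod int m)" for j
  proof -
    have "[(r ^ n) ^ (j div n) * r ^ (j mod n) = 1 ^ (j div n) * r ^ (j mod n)] (mod int m)"
      by (intro cong_mult cong_pow r cong_refl)
    then show ?thesis
      by (simp flip: power_mult power_add)
  qed
  have "[r ^ exponent_b n v = r ^ exponent_b n v'] (mod int m)"
    using pow[of "exponent_b n v"] pow[of "exponent_b n v'"] append.IH(2)
    by (metis cong_def)
  with append.IH show ?case
    by (auto simp: exponent_b_append exponent_a_append intro: cong_add cong_mult)
qed (auto intro: cong_sym cong_trans)

section \<open>From the presentation to unique normal forms\<close>

text \<open>Turns the defining relations, written with \<open>gen_pow\<close>, into equations
  between powers in the group.\<close>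

lemma pres_class_gen_pow:
  "pres_class R (gen_pow x k) = pres_class R [(x, True)] [^]\<^bsub>presented_group R\<^esub> k"
proof -
  interpret group "presented_group R"
    by (rule group_presented_group)
  have one: "\<one>\<^bsub>presented_group R\<^esub> = pres_class R []"
    and carrier [simp]: "pres_class R u \<in> carrier (presented_group R)" for u
    by (simp_all add: presented_group_def)
  have pow: "pres_class R (replicate l y) = pres_class R [y] [^]\<^bsub>presented_group R\<^esub> l" for l y
  proof (induction l)
    case (Suc l)
    show ?case
      by (simp add: Suc[symmetric] presented_group_mult replicate_append_same)
  qed (simp add: one)
  have "inv\<^bsub>presented_group R\<^esub> pres_class R [(x, True)] = pres_class R [(x, False)]"
    using pres_eq.cancel[of R x False]
    by (intro inv_equality) (simp_all add: presented_group_mult one pres_class_eq_iff)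
  then have neg: "pres_class R [(x, False)] [^]\<^bsub>presented_group R\<^esub> l =
      inv\<^bsub>presented_group R\<^esub> (pres_class R [(x, True)] [^]\<^bsub>presented_group R\<^esub> l)" for l :: nat
    using nat_pow_inv[OF carrier, of "[(x, True)]" l] by simp
  show ?thesis
  proof (cases "0 \<le> k")
    case True
    then have "gen_pow x k = replicate (nat k) (x, True)"
      by (simp add: gen_pow_def)
    then show ?thesis
      using True by (simp only: pow int_pow_def2 not_less[symmetric] if_False)
  next
    case False
    then have "gen_pow x k = replicate (nat (- k)) (x, False)"
      by (simp add: gen_pow_def)
    then show ?thesis
      using False by (simp only: pow neg int_pow_def2 not_le if_True)
  qed
qed

text \<open>Normal forms exist by induction on words; they are unique because the exponents of a
  word are invariants of its class.\<close>

lemma split_metacyclic_ZM: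
  assumes m: "m \<ge> 1" and n: "n \<ge> 1" and r: "[r ^ n = 1] (mod int m)"
  shows "split_metacyclic (ZM m n r)
    (pres_class (ZM_relations m n r) [(gen_a, True)])
    (pres_class (ZM_relations m n r) [(gen_b, True)]) r m n"
proof -
  let ?R = "ZM_relations m n r"
  let ?cls = "pres_class ?R"
  define a where "a = ?cls [(gen_a, True)]"
  define b where "b = ?cls [(gen_b, True)]"
  interpret group "ZM m n r"
    unfolding ZM_eq by (rule group_presented_group)
  note gen_pow = pres_class_gen_pow[of ?R, folded ZM_eq]
  note mult = presented_group_mult[of ?R, folded ZM_eq]
  have one: "\<one>\<^bsub>ZM m n r\<^esub> = ?cls []" and carrier: "carrier (ZM m n r) = range ?cls"
    by (simp_all add: ZM_eq presented_group_def)
  have closed [simp]: "a \<in> carrier (ZM m n r)" "b \<in> carrier (ZM m n r)"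
    by (simp_all add: carrier a_def b_def)
  have relation: "?cls u = ?cls v" if "(u, v) \<in> ?R" for u v
    using that by (simp add: pres_class_eq_iff pres_eq.relation)
  have pow_a: "a [^]\<^bsub>ZM m n r\<^esub> int m = \<one>\<^bsub>ZM m n r\<^esub>"
    unfolding a_def one gen_pow[symmetric] by (intro relation) (simp add: ZM_relations_def)
  have pow_b: "b [^]\<^bsub>ZM m n r\<^esub> int n = \<one>\<^bsub>ZM m n r\<^esub>"
    unfolding b_def one gen_pow[symmetric] by (intro relation) (simp add: ZM_relations_def)
  have "b [^]\<^bsub>ZM m n r\<^esub> (- 1 :: int) \<otimes>\<^bsub>ZM m n r\<^esub> (a [^]\<^bsub>ZM m n r\<^esub> (1 :: int) \<otimes>\<^bsub>ZM m n r\<^esub>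
      b [^]\<^bsub>ZM m n r\<^esub> (1 :: int)) = a [^]\<^bsub>ZM m n r\<^esub> r"
    unfolding a_def b_def gen_pow[symmetric] mult
    by (intro relation) (simp add: ZM_relations_def)
  then have "inv\<^bsub>ZM m n r\<^esub> b \<otimes>\<^bsub>ZM m n r\<^esub> a \<otimes>\<^bsub>ZM m n r\<^esub> b = a [^]\<^bsub>ZM m n r\<^esub> r"
    by (simp add: int_pow_neg m_assoc)
  then interpret conjugation_by_power "ZM m n r" a b r
    by unfold_locales simp_all
  have letter: "\<exists>(l::nat) (k::int). ?cls [y] = b [^]\<^bsub>ZM m n r\<^esub> l \<otimes>\<^bsub>ZM m n r\<^esub> a [^]\<^bsub>ZM m n r\<^esub> k"
    for y
  proof -
    obtain x s where y: "y = (x, s)"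
      by fastforce
    have a': "?cls [(gen_a, s)] = a [^]\<^bsub>ZM m n r\<^esub> (if s then 1 else - 1 :: int)"
      unfolding a_def gen_pow[symmetric] by (simp add: gen_pow_def)
    have b': "?cls [(gen_b, s)] = b [^]\<^bsub>ZM m n r\<^esub> (if s then 1 else - 1 :: int)"
      unfolding b_def gen_pow[symmetric] by (simp add: gen_pow_def)
    \<comment> \<open>The relation for \<open>b\<close> replaces the exponent \<open>- 1\<close> by
      \<open>n - 1\<close>, as the normal form requires a natural exponent.\<close>
    also have "\<dots> = b [^]\<^bsub>ZM m n r\<^esub> (if s then 1 else int n - 1)"
      by (simp add: int_pow_diff int_pow_neg pow_b)
    also have "\<dots> = b [^]\<^bsub>ZM m n r\<^esub> (if s then 1 else n - 1)"
      using n by (simp add: of_nat_diff flip: int_pow_int)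
    finally have b': "?cls [(gen_b, s)] = b [^]\<^bsub>ZM m n r\<^esub> (if s then 1 else n - 1)" .
    show ?thesis
    proof (cases x)
      case gen_a
      then show ?thesis
        using a' by (intro exI[of _ 0] exI[of _ "if s then 1 else - 1 :: int"]) (simp add: y)
    next
      case gen_b
      then show ?thesis
        using b' by (intro exI[of _ "if s then 1 else n - 1"] exI[of _ 0]) (simp add: y)
    qed
  qed
  have word: "\<exists>(j::nat) (i::int). ?cls w = b [^]\<^bsub>ZM m n r\<^esub> j \<otimes>\<^bsub>ZM m n r\<^esub> a [^]\<^bsub>ZM m n r\<^esub> i"
    for w
  proof (induction w)
    case Nil
    show ?case
      by (intro exI[of _ 0]) (simp flip: one)
  next
    case (Cons y w)
    have "?cls (y # w) = ?cls [y] \<otimes>\<^bsub>ZM m n r\<^esub> ?cls w"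
      by (simp add: mult)
    then show ?case
      using letter[of y] Cons.IH normal_form_mult by metis
  qed
  have eq_one: "b [^]\<^bsub>ZM m n r\<^esub> j \<otimes>\<^bsub>ZM m n r\<^esub> a [^]\<^bsub>ZM m n r\<^esub> i = \<one>\<^bsub>ZM m n r\<^esub> \<longleftrightarrow>
      n dvd j \<and> int m dvd i" for j :: nat and i :: int
  proof
    \<comment> \<open>This word represents the normal form and has exponents exactly
      \<open>j\<close> and \<open>i\<close>; comparison with the empty word gives the
      divisibilities.\<close>
    let ?w = "gen_pow gen_b (int j) @ gen_pow gen_a i"
    assume "b [^]\<^bsub>ZM m n r\<^esub> j \<otimes>\<^bsub>ZM m n r\<^esub> a [^]\<^bsub>ZM m n r\<^esub> i = \<one>\<^bsub>ZM m n r\<^esub>"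
    then have "?cls ?w = ?cls []"
      unfolding one int_pow_int[symmetric] a_def b_def gen_pow[symmetric] mult .
    then have "pres_eq ?R ?w []"
      by (simp add: pres_class_eq_iff)
    from pres_eq_ZM_imp_exponents_cong[OF this n r] show "n dvd j \<and> int m dvd i"
      by (simp add: exponent_b_append exponent_a_append exponents_gen_pow_a exponents_gen_pow_b
          cong_0_iff)
  next
    assume "n dvd j \<and> int m dvd i"
    then obtain q p where "j = n * q" "i = int m * p"
      by (auto simp: dvd_def)
    moreover have "b [^]\<^bsub>ZM m n r\<^esub> (n * q) = \<one>\<^bsub>ZM m n r\<^esub>"
      using pow_b by (simp add: int_pow_int flip: nat_pow_pow)
    moreover have "a [^]\<^bsub>ZM m n r\<^esub> (int m * p) = \<one>\<^bsub>ZM m n r\<^esub>"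
      using pow_a by (simp flip: int_pow_pow)
    ultimately show "b [^]\<^bsub>ZM m n r\<^esub> j \<otimes>\<^bsub>ZM m n r\<^esub> a [^]\<^bsub>ZM m n r\<^esub> i = \<one>\<^bsub>ZM m n r\<^esub>"
      by simp
  qed
  have "split_metacyclic (ZM m n r) a b r m n"
    using m n word eq_one by unfold_locales (auto simp: carrier)
  then show ?thesis
    by (simp add: a_def b_def)
qed

theorem corollary2:
  fixes m n :: nat and r :: int
  assumes "m \<ge> 1" and "n \<ge> 1"
    and "gcd m n = 1" and "gcd (int m) (r - 1) = 1"
    and "[r ^ n = 1] (mod int m)"
  shows "card (normal_subgroups (ZM m n r)) =
    (\<Sum>n\<^sub>1 | n\<^sub>1 dvd n. divisor_count (nat (gcd (int m) (r ^ n\<^sub>1 - 1))))"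
proof -
  interpret split_metacyclic "ZM m n r"
    "pres_class (ZM_relations m n r) [(gen_a, True)]"
    "pres_class (ZM_relations m n r) [(gen_b, True)]" r m n
    using assms by (intro split_metacyclic_ZM)
  show ?thesis
    using assms(4) by (intro card_normal_subgroups) (simp add: coprime_iff_gcd_eq_1)
qed

end
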